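(* Let $d\ge1$, $h>0$ and let $u\in\ell^2((h\mathbb Z)^d)$ be a solution to $\Delta_{\mathrm d}u_j+V_ju_j=0$ for all $j\in\mathbb Z^d$, where $V$ is a bounded potential on $(h\mathbb Z)^d$ and $\|V\|_\infty$, $\|u\|_{\ell^2}$ are finite and independent of $h$. \begin{enumerate} \item There exists $\mu_0=\mu_0(d)$ such that if $h^d\sum_{j\in\mathbb Z^d}e^{\mu_0|jh|^{4/3}}|u_j|^2<\infty$ uniformly with respect to $h$, then there exists $h_0>0$ such that $h\in(0,h_0)$ implies $u\equiv0$. \item There exists $\mu_0=\mu_0(d)$ such that if, for some $\beta>3$, $h^d\sum_{j\in\mathbb Z^d}e^{\mu_0|jh|^{1+1/\beta}\log|jh|}|u_j|^2<\infty$ uniformly with respect to $h$, then there exists $h_0>0$ such that $h\in(0,h_0)$ implies $u\equiv0$. \item There exists $\mu_0=\mu_0(d)$ such that if $h^d\sum_{j\in\mathbb Z^d}e^{\mu_0|j|\log(|j|h)}|u_j|^2<\infty$, then $u\equiv0$. \end{enumerate}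
   Context: For $h>0$, functions on $(h\mathbb Z)^d$ are indexed by $j\in\mathbb Z^d$ via $f_j=f(hj)$. The discrete Laplacian is $\Delta_{\mathrm d}f_j:=h^{-2}\sum_{k=1}^d(f_{j+e_k}-2f_j+f_{j-e_k})$. $\|u\|_{\ell^2}=(h^d\sum_j|u_j|^2)^{1/2}$, $\|V\|_\infty=\sup_j|V_j|$, and $|\cdot|$ is the Euclidean norm. *)

theory Defs
  imports "HOL-Analysis.Analysis"
begin

text \<open>Lattice points j in Z^d are functions 'n => int with 'n a finite index type, d = CARD('n).
  Grid functions f on (hZ)^d are indexed by j, f_j = f(hj).\<close>

definition unit_vec :: "'n \<Rightarrow> ('n \<Rightarrow> int)" where
  "unit_vec k = (\<lambda>i. if i = k then 1 else 0)"

definition lnorm :: "('n::finite \<Rightarrow> int) \<Rightarrow> real" where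
  "lnorm j = sqrt (\<Sum>k\<in>UNIV. (real_of_int (j k))\<^sup>2)"

definition disc_lap :: "real \<Rightarrow> (('n::finite \<Rightarrow> int) \<Rightarrow> complex) \<Rightarrow> ('n \<Rightarrow> int) \<Rightarrow> complex" where
  "disc_lap h f j = complex_of_real (1 / h\<^sup>2) *
     (\<Sum>k\<in>UNIV. f (\<lambda>i. j i + unit_vec k i) - 2 * f j + f (\<lambda>i. j i - unit_vec k i))"

definition wsum :: "real \<Rightarrow> (('n::finite \<Rightarrow> int) \<Rightarrow> real) \<Rightarrow> (('n \<Rightarrow> int) \<Rightarrow> complex) \<Rightarrow> real" where
  "wsum h w u = h ^ CARD('n) * (\<Sum>\<^sub>\<infinity>j. w j * (norm (u j))\<^sup>2)"

definition wfinite :: "(('n::finite \<Rightarrow> int) \<Rightarrow> real) \<Rightarrow> (('n \<Rightarrow> int) \<Rightarrow> complex) \<Rightarrow> bool" where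
  "wfinite w u \<longleftrightarrow> (\<lambda>j. w j * (norm (u j))\<^sup>2) summable_on UNIV"

end

theory Submission
  imports Defs "HOL-Real_Asymp.Real_Asymp"
begin

text \<open>The equation at j + e_k expresses u_j through values of u whose k-th coordinate exceeds j_k.
  Hence the suprema of |u| over the half-spaces {j_k >= m} grow at most by a constant factor
  (depending on h) when m decreases by one. A solution that decays faster than every exponential
  must therefore vanish, and for each fixed h all three weights force such a decay.\<close>

lemma abs_coord_le_lnorm: "\<bar>real_of_int (j k)\<bar> \<le> lnorm j"
proof -
  have "(real_of_int (j k))\<^sup>2 \<le> (\<Sum>k\<in>UNIV. (real_of_int (j k))\<^sup>2)"
    by (rule member_le_sum) auto
  then have "sqrt ((real_of_int (j k))\<^sup>2) \<le> lnorm j"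
    unfolding lnorm_def by (rule real_sqrt_le_mono)
  then show ?thesis by simp
qed

text \<open>A single term of a summable nonnegative family is at most the whole sum, which serves as
  \<open>S\<close>. This converts a weighted sum into pointwise decay of \<open>u\<close>.\<close>

lemma wfinite_pointwise_bound:
  assumes "wfinite w u" and "\<And>j. 0 \<le> w j"
  obtains S where "S \<ge> 0" "\<And>j. w j * (norm (u j))\<^sup>2 \<le> S"
proof
  let ?f = "\<lambda>j. w j * (norm (u j))\<^sup>2"
  have nn: "0 \<le> ?f j" for j by (simp add: assms(2))
  then show "infsum ?f UNIV \<ge> 0" by (intro infsum_nonneg) auto
  show "?f j \<le> infsum ?f UNIV" for j
    using finite_sum_le_infsum[of ?f UNIV "{j}"] assms(1) nn by (auto simp: wfinite_def)
qed

text \<open>Among the points in the equation centred at \<open>i + e_k\<close>, only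
  \<open>i\<close> can fall outside the half-space where \<open>M\<close> bounds \<open>u\<close>.
  Multiplying by \<open>h\<^sup>2\<close> and solving for \<open>u i\<close> gives the factor: the
  second differences cost at most \<open>4 * M\<close> per direction and the potential costs
  \<open>h\<^sup>2 * CV * M\<close>.\<close>

lemma half_space_step:
  fixes u V :: "('n::finite \<Rightarrow> int) \<Rightarrow> complex" and h CV M :: real
  assumes "h > 0" and V: "\<And>j. norm (V j) \<le> CV"
    and eq: "\<And>j. disc_lap h u j + V j * u j = 0"
    and "M \<ge> 0" and M: "\<And>j. j k \<ge> m + 1 \<Longrightarrow> norm (u j) \<le> M"
    and i: "i k \<ge> m"
  shows "norm (u i) \<le> (4 * real CARD('n) + h\<^sup>2 * CV) * M"
proof -
  define p where "p = (\<lambda>l. i l + unit_vec k l)"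
  define t where "t = (\<lambda>l. u (\<lambda>i. p i + unit_vec l i) - 2 * u p + u (\<lambda>i. p i - unit_vec l i))"
  have up: "norm (u p) \<le> M" using i by (intro M) (auto simp: p_def unit_vec_def)
  have fwd: "norm (u (\<lambda>i. p i + unit_vec l i)) \<le> M" for l
    using i by (intro M) (auto simp: p_def unit_vec_def)
  \<comment> \<open>A shift along \<open>l \<noteq> k\<close> leaves the \<open>k\<close>-th
    coordinate at \<open>i k + 1\<close>; for \<open>l = k\<close> the backward neighbour is
    \<open>i\<close> itself.\<close>
  have bwd: "norm (u (\<lambda>i. p i - unit_vec l i)) \<le> M" if "l \<noteq> k" for l
    using i that by (intro M) (auto simp: p_def unit_vec_def)
  have two: "norm (a - 2 * b) \<le> 3 * M" if "norm a \<le> M" "norm b \<le> M" for a b :: complex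
    using norm_triangle_ineq4[of a "2 * b"] that by (simp add: norm_mult)
  have t_le: "norm (t l) \<le> 4 * M" if "l \<noteq> k" for l
    unfolding t_def
    using norm_triangle_ineq[of "u (\<lambda>i. p i + unit_vec l i) - 2 * u p" "u (\<lambda>i. p i - unit_vec l i)"]
      two[OF fwd[of l] up] bwd[OF that] by linarith
  have tk: "t k = (u (\<lambda>i. p i + unit_vec k i) - 2 * u p) + u i"
    unfolding t_def by (simp add: p_def)
  have "(\<Sum>l\<in>UNIV. t l) / of_real (h\<^sup>2) + V p * u p = 0"
    using eq[of p] by (simp add: disc_lap_def t_def)
  then have "(\<Sum>l\<in>UNIV. t l) = - (of_real (h\<^sup>2) * V p * u p)"
    using \<open>h > 0\<close> by (simp add: field_simps eq_neg_iff_add_eq_0)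
  moreover have "(\<Sum>l\<in>UNIV. t l) = t k + (\<Sum>l\<in>UNIV - {k}. t l)"
    by (simp add: sum.remove[of UNIV k])
  ultimately have ui: "u i = - (of_real (h\<^sup>2) * V p * u p) - (\<Sum>l\<in>UNIV - {k}. t l)
      - (u (\<lambda>i. p i + unit_vec k i) - 2 * u p)" (is "_ = - ?a - ?b - ?c")
    using tk by (simp add: algebra_simps)
  have "norm ?a = h\<^sup>2 * (norm (V p) * norm (u p))"
    by (simp add: norm_mult norm_power)
  also have "\<dots> \<le> h\<^sup>2 * (CV * M)"
    using V[of p] up order_trans[OF norm_ge_zero V[of p]]
    by (intro mult_left_mono mult_mono) auto
  finally have a: "norm ?a \<le> h\<^sup>2 * CV * M" by simp
  have b: "norm ?b \<le> (real CARD('n) - 1) * (4 * M)"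
  proof -
    have "norm ?b \<le> (\<Sum>l\<in>UNIV - {k}. 4 * M)" by (intro sum_norm_le) (auto intro: t_le)
    then show ?thesis by (simp add: of_nat_diff)
  qed
  have "norm (u i) \<le> norm ?a + norm ?b + norm ?c"
    unfolding ui using norm_triangle_ineq4[of "- ?a - ?b" ?c] norm_triangle_ineq4[of "- ?a" ?b]
    by (simp only: norm_minus_cancel)
  \<comment> \<open>Direction \<open>k\<close> has lost its term \<open>u i\<close> and contributes
    only \<open>3 * M\<close>, so the total \<open>4 * (d - 1) + 3\<close> is rounded up to
    \<open>4 * d\<close>.\<close>
  also have "\<dots> \<le> h\<^sup>2 * CV * M + (real CARD('n) - 1) * (4 * M) + 3 * M"
    by (intro add_mono a b two fwd up)
  also have "\<dots> \<le> (4 * real CARD('n) + h\<^sup>2 * CV) * M"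
    using \<open>M \<ge> 0\<close> by (simp add: algebra_simps)
  finally show ?thesis .
qed

text \<open>Induction on the number of layers: the induction hypothesis at \<open>m + 1\<close>
  bounds \<open>u\<close> on the next half-space, and one more step brings the bound back to
  \<open>m\<close>. Hence \<open>m\<close> and \<open>i\<close> are generalised.\<close>

lemma half_space_iterate:
  fixes u V :: "('n::finite \<Rightarrow> int) \<Rightarrow> complex" and h CV M :: real
  assumes "h > 0" and V: "\<And>j. norm (V j) \<le> CV"
    and eq: "\<And>j. disc_lap h u j + V j * u j = 0"
    and "M \<ge> 0" and M: "\<And>j. j k \<ge> m + int n \<Longrightarrow> norm (u j) \<le> M"
    and i: "i k \<ge> m"
  shows "norm (u i) \<le> (4 * real CARD('n) + h\<^sup>2 * CV) ^ n * M"
  using M i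
proof (induction n arbitrary: m i)
  case (Suc n)
  have "0 \<le> CV" using order_trans[OF norm_ge_zero V] .
  then have "0 \<le> (4 * real CARD('n) + h\<^sup>2 * CV) ^ n * M" using \<open>M \<ge> 0\<close> by simp
  moreover have "norm (u j) \<le> (4 * real CARD('n) + h\<^sup>2 * CV) ^ n * M" if "j k \<ge> m + 1" for j
    using that by (intro Suc.IH[of "m + 1"] Suc.prems(1)) auto
  ultimately show ?case
    using half_space_step[OF \<open>h > 0\<close> V eq, of "(4 * real CARD('n) + h\<^sup>2 * CV) ^ n * M" m k i] Suc.prems(2)
    by (simp add: mult.assoc)
qed simp

text \<open>Two rates compete: coming back over \<open>n\<close> layers costs \<open>K ^ n\<close>,
  while superlinear growth of \<open>\<phi>\<close> makes \<open>u\<close> decay like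
  \<open>exp (- A * n)\<close> with \<open>A\<close> as large as desired. Taking \<open>A\<close>
  large enough to win forces \<open>u j = 0\<close>.\<close>

lemma superexponential_decay_imp_zero:
  fixes u V :: "('n::finite \<Rightarrow> int) \<Rightarrow> complex" and h CV :: real
  assumes "h > 0" and V: "\<And>j. norm (V j) \<le> CV"
    and eq: "\<And>j. disc_lap h u j + V j * u j = 0"
    and fin: "wfinite (\<lambda>j. exp (\<phi> (lnorm j))) u"
    and \<phi>: "filterlim (\<lambda>r. \<phi> r / r) at_top at_top"
  shows "u j = 0"
proof -
  obtain S where S: "S \<ge> 0" "\<And>j. exp (\<phi> (lnorm j)) * (norm (u j))\<^sup>2 \<le> S"
    using wfinite_pointwise_bound[OF fin] by auto
  define K where "K = 4 * real CARD('n) + h\<^sup>2 * CV"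
  have "0 \<le> CV" using order_trans[OF norm_ge_zero V] .
  then have K: "K > 0" by (simp add: K_def add_pos_nonneg)
  \<comment> \<open>Chosen so that \<open>K * exp (- A) \<le> 1/2\<close>. The maximum with
    \<open>0\<close> keeps \<open>A * r\<close> monotone in \<open>r\<close>.\<close>
  define A where "A = max 0 (ln (2 * K))"
  \<comment> \<open>The factor 2 compensates the square root taken in \<open>decay\<close>, since
    the weight multiplies the square of the norm.\<close>
  have "eventually (\<lambda>r. 2 * A \<le> \<phi> r / r) at_top"
    using \<phi> by (simp add: filterlim_at_top)
  then have "eventually (\<lambda>r. 2 * A * r \<le> \<phi> r) at_top"
    using eventually_gt_at_top[of 0] by eventually_elim (simp add: field_simps)
  then obtain R where R: "\<And>r. r \<ge> R \<Longrightarrow> 2 * A * r \<le> \<phi> r"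
    by (auto simp: eventually_at_top_linorder)
  have decay: "norm (u i) \<le> sqrt S * exp (- A * r)" if "r \<ge> R" "r \<le> lnorm i" for i r
  proof -
    have "2 * A * r \<le> 2 * A * lnorm i" using that by (intro mult_left_mono) (auto simp: A_def)
    also have "\<dots> \<le> \<phi> (lnorm i)" using that by (intro R) auto
    finally have "exp (2 * A * r) * (norm (u i))\<^sup>2 \<le> S"
      by (intro order_trans[OF mult_right_mono S(2)]) auto
    moreover have "exp (2 * A * r) * (norm (u i))\<^sup>2 = (exp (A * r) * norm (u i))\<^sup>2"
      by (simp add: power_mult_distrib exp_double[symmetric] mult.assoc)
    ultimately have "exp (A * r) * norm (u i) \<le> sqrt S" by (simp add: real_le_rsqrt)
    then show ?thesis by (simp add: exp_minus field_simps)
  qed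
  \<comment> \<open>Any coordinate direction will do; one exists because types are nonempty, which
    encodes \<open>d \<ge> 1\<close>.\<close>
  obtain k :: 'n where True by simp
  define c where "c = sqrt S * exp (- A * real_of_int (j k))"
  \<comment> \<open>The lower bound on \<open>n\<close> puts the far half-space beyond
    \<open>R\<close>, where the decay estimate is available.\<close>
  have "norm (u j) \<le> c * (1/2) ^ n" if n: "real n \<ge> R - real_of_int (j k)" for n
  proof -
    let ?M = "sqrt S * exp (- A * real_of_int (j k + int n))"
    have "norm (u i) \<le> ?M" if "i k \<ge> j k + int n" for i
    proof (rule decay)
      show "real_of_int (j k + int n) \<ge> R" using n by simp
      have "real_of_int (j k + int n) \<le> real_of_int (i k)" using that by (simp only: of_int_le_iff)
      then show "real_of_int (j k + int n) \<le> lnorm i" using abs_coord_le_lnorm[of i k] by linarith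
    qed
    then have "norm (u j) \<le> K ^ n * ?M"
      unfolding K_def by (intro half_space_iterate[OF \<open>h > 0\<close> V eq, of _ "j k" n k]) (use S in auto)
    also have "\<dots> = c * (K * exp (- A)) ^ n"
      by (simp add: c_def power_mult_distrib exp_of_nat_mult[symmetric] exp_add[symmetric] algebra_simps)
    also have "\<dots> \<le> c * (1/2) ^ n"
    proof -
      have "2 * K = exp (ln (2 * K))" using K by simp
      also have "\<dots> \<le> exp A" by (simp add: A_def)
      finally have "K * exp (- A) \<le> 1/2" by (simp add: exp_minus field_simps)
      then show ?thesis using K S by (intro mult_left_mono power_mono) (auto simp: c_def)
    qed
    finally show ?thesis .
  qed
  then have "eventually (\<lambda>n. norm (u j) \<le> c * (1/2) ^ n) sequentially"
    using filterlim_real_sequentially[unfolded filterlim_at_top, rule_format, of "R - real_of_int (j k)"]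
    by (rule eventually_mono[rotated])
  moreover have "(\<lambda>n. c * (1/2) ^ n) \<longlonglongrightarrow> 0" by real_asymp
  ultimately have "norm (u j) \<le> 0"
    by (intro tendsto_lowerbound[of _ 0 sequentially]) auto
  then show ?thesis by simp
qed

theorem theorem1p2:
  fixes dummy :: "'n::finite itself"
  shows
  "(\<exists>\<mu>0>0. \<forall>(u :: real \<Rightarrow> ('n \<Rightarrow> int) \<Rightarrow> complex) (V :: real \<Rightarrow> ('n \<Rightarrow> int) \<Rightarrow> complex).
      (\<exists>CV. \<forall>h>0. \<forall>j. norm (V h j) \<le> CV) \<longrightarrow>
      (\<exists>Cu. \<forall>h>0. wfinite (\<lambda>_. 1) (u h) \<and> wsum h (\<lambda>_. 1) (u h) \<le> Cu) \<longrightarrow>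
      (\<forall>h>0. \<forall>j. disc_lap h (u h) j + V h j * u h j = 0) \<longrightarrow>
      (\<exists>C. \<forall>h>0. wfinite (\<lambda>j. exp (\<mu>0 * (h * lnorm j) powr (4/3))) (u h) \<and>
                 wsum h (\<lambda>j. exp (\<mu>0 * (h * lnorm j) powr (4/3))) (u h) \<le> C) \<longrightarrow>
      (\<exists>h0>0. \<forall>h. 0 < h \<and> h < h0 \<longrightarrow> (\<forall>j. u h j = 0)))
 \<and>
   (\<exists>\<mu>0>0. \<forall>(\<beta>::real) (u :: real \<Rightarrow> ('n \<Rightarrow> int) \<Rightarrow> complex) (V :: real \<Rightarrow> ('n \<Rightarrow> int) \<Rightarrow> complex).
      \<beta> > 3 \<longrightarrow>
      (\<exists>CV. \<forall>h>0. \<forall>j. norm (V h j) \<le> CV) \<longrightarrow>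
      (\<exists>Cu. \<forall>h>0. wfinite (\<lambda>_. 1) (u h) \<and> wsum h (\<lambda>_. 1) (u h) \<le> Cu) \<longrightarrow>
      (\<forall>h>0. \<forall>j. disc_lap h (u h) j + V h j * u h j = 0) \<longrightarrow>
      (\<exists>C. \<forall>h>0.
          wfinite (\<lambda>j. exp (\<mu>0 * (h * lnorm j) powr (1 + 1/\<beta>) * ln (h * lnorm j))) (u h) \<and>
          wsum h (\<lambda>j. exp (\<mu>0 * (h * lnorm j) powr (1 + 1/\<beta>) * ln (h * lnorm j))) (u h) \<le> C) \<longrightarrow>
      (\<exists>h0>0. \<forall>h. 0 < h \<and> h < h0 \<longrightarrow> (\<forall>j. u h j = 0)))
 \<and>
   (\<exists>\<mu>0>0. \<forall>(h::real) (u :: ('n \<Rightarrow> int) \<Rightarrow> complex) (V :: ('n \<Rightarrow> int) \<Rightarrow> complex).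
      h > 0 \<longrightarrow>
      (\<exists>CV. \<forall>j. norm (V j) \<le> CV) \<longrightarrow>
      wfinite (\<lambda>_. 1) u \<longrightarrow>
      (\<forall>j. disc_lap h u j + V j * u j = 0) \<longrightarrow>
      wfinite (\<lambda>j. exp (\<mu>0 * lnorm j * ln (lnorm j * h))) u \<longrightarrow>
      (\<forall>j. u j = 0))"
\<comment> \<open>The value 1 instantiates both \<open>\<mu>0\<close> and \<open>h0\<close>: each
  exponent is superlinear for any positive factor, and the argument treats every
  \<open>h > 0\<close> separately.\<close>
proof (intro conjI exI[of _ "1::real"] allI impI; (elim exE)?)
  fix u V :: "real \<Rightarrow> ('n \<Rightarrow> int) \<Rightarrow> complex" and CV C :: real
  assume V: "\<forall>h>0. \<forall>j. norm (V h j) \<le> CV"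
  and eq: "\<forall>h>0. \<forall>j. disc_lap h (u h) j + V h j * u h j = 0"
  and w: "\<forall>h>0. wfinite (\<lambda>j. exp (1 * (h * lnorm j) powr (4/3))) (u h) \<and>
            wsum h (\<lambda>j. exp (1 * (h * lnorm j) powr (4/3))) (u h) \<le> C"
  fix h :: real and j assume "0 < h \<and> h < 1"
  then have h: "h > 0" by simp
  have "filterlim (\<lambda>r. 1 * (h * r) powr (4/3) / r) at_top at_top"
    using h by real_asymp
  then show "u h j = 0"
    using V eq w h
    by (intro superexponential_decay_imp_zero[of h "V h" CV "u h" "\<lambda>r. 1 * (h * r) powr (4/3)"]) auto
next
  fix \<beta> :: real and u V :: "real \<Rightarrow> ('n \<Rightarrow> int) \<Rightarrow> complex" and CV C :: real
  assume "\<beta> > 3" and V: "\<forall>h>0. \<forall>j. norm (V h j) \<le> CV"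
  and eq: "\<forall>h>0. \<forall>j. disc_lap h (u h) j + V h j * u h j = 0"
  and w: "\<forall>h>0.
        wfinite (\<lambda>j. exp (1 * (h * lnorm j) powr (1 + 1/\<beta>) * ln (h * lnorm j))) (u h) \<and>
        wsum h (\<lambda>j. exp (1 * (h * lnorm j) powr (1 + 1/\<beta>) * ln (h * lnorm j))) (u h) \<le> C"
  fix h :: real and j assume "0 < h \<and> h < 1"
  then have h: "h > 0" by simp
  \<comment> \<open>With \<open>a > 0\<close> as a separate parameter, the quotient below is a
    positive constant times \<open>r powr a * ln (h * r)\<close> for large \<open>r\<close>, a form
    whose limit \<open>real_asymp\<close> can decide.\<close>
  define a where "a = 1/\<beta>"
  have a: "a > 0" using \<open>\<beta> > 3\<close> by (simp add: a_def)
  have "filterlim (\<lambda>r. 1 * (h * r) powr (1 + a) * ln (h * r) / r) at_top at_top"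
    using h a by real_asymp
  then show "u h j = 0"
    using V eq w h
    by (intro superexponential_decay_imp_zero[of h "V h" CV "u h"
          "\<lambda>r. 1 * (h * r) powr (1 + 1/\<beta>) * ln (h * r)"]) (auto simp: a_def)
next
  fix h CV :: real and u V :: "('n \<Rightarrow> int) \<Rightarrow> complex" and j
  assume h: "h > 0" and V: "\<forall>j. norm (V j) \<le> CV"
  and eq: "\<forall>j. disc_lap h u j + V j * u j = 0"
  and w: "wfinite (\<lambda>j. exp (1 * lnorm j * ln (lnorm j * h))) u"
  \<comment> \<open>Here the quotient is just \<open>ln (r * h)\<close>: the growth is barely
    superlinear, yet it beats every fixed \<open>A\<close>.\<close>
  have "filterlim (\<lambda>r. 1 * r * ln (r * h) / r) at_top at_top"
  using h by real_asymp
  then show "u j = 0"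
  using V eq w h
  by (intro superexponential_decay_imp_zero[of h V CV u "\<lambda>r. 1 * r * ln (r * h)"]) auto
qed (simp_all)

end
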